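(* Let $F=\{\mathbf{x}^{v_1},\ldots,\mathbf{x}^{v_n}\}\subset k[x_1,\ldots,x_n]$ $(n\geq 2)$ be a monomial Cremona set in degree $2$ satisfying the canonical restrictions, and let $G_F$ be the corresponding graph. Let $r$ denote the length of the root circuit of $G_F$ and let $s$ be the number of vertices of $G_F$ off the root circuit whose vertex degree is $\geq 2$. Let the variables and the monomials of $F$ be ordered so that the log-matrix of $F$ is in normal form $\mathcal{N}_F$. Then: (a) The degree of the Cremona inverse $F^{-1}$ is $(r+1)/2+s$. (b) The entries of the Cremona inverse matrix $A_{F^{-1}}$ satisfy the following conditions: (i) the entries on the main diagonal are all nonzero; (ii) all entries belong to $\{0,1,2\}$; moreover, $2$ is an entry on the $i$th row if and only if the corresponding vertex $x_i$ does not belong to the root circuit of $G_F$ and has degree $\geq 2$; in particular, the inverse map is defined by squarefree monomials if and only if the root circuit of $G_F$ has empty second neighborhood. (c) Let $\widetilde{G_F}$ be the subgraph obtained from $G_F$ by omitting the vertices of degree $1$ and the corresponding incident edges, and let $\{f_{i_1},\ldots,f_{i_m}\}$ be the monomials corresponding to the edges of $\widetilde{G_F}$ not belonging to the root circuit $\{x_1,\ldots,x_r\}$ of $G_F$. Then the inversion monomial factor of $F$ is $x_1\cdots x_r\, f_{i_1}\cdots f_{i_m}$.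
   Context: Let $k$ be a field (of arbitrary characteristic) and $n\ge 2$. For $v=(a_1,\ldots,a_n)\in\mathbb{N}^n$ write $\mathbf{x}^v=x_1^{a_1}\cdots x_n^{a_n}$ and $|v|=a_1+\cdots+a_n$. Let $F=\{\mathbf{x}^{v_1},\ldots,\mathbf{x}^{v_n}\}$ be a set of $n$ distinct monomials of the same degree. Its log-matrix $A_F$ is the $n\times n$ matrix whose $j$th column is $v_j$ (it depends on the chosen orderings of the variables and of the monomials). $F$ satisfies the canonical restrictions if the monomials have no non-trivial common factor and every variable divides at least one of them. $F$ is a Cremona set if the rational map $\mathbb{P}^{n-1}\dashrightarrow\mathbb{P}^{n-1}$ with coordinates $(\mathbf{x}^{v_1}:\cdots:\mathbf{x}^{v_n})$ is birational; it is in degree $2$ if the monomials have degree $2$. Inverse. For a Cremona set $F$ of degree $d$ satisfying the canonical restrictions, there are a unique set $F^{-1}$ of $n$ monomials of a common degree satisfying the canonical restrictions, with log-matrix $A_{F^{-1}}$, and a unique vector $\gamma\in\mathbb{N}^n$ such that $A_F\cdot A_{F^{-1}}=[\gamma|\cdots|\gamma]+I_n$; the set $F^{-1}$ defines the inverse map. $F^{-1}$ is called the Cremona inverse (set), its degree is the common degree of its monomials, $A_{F^{-1}}$ is the Cremona inverse matrix, and $\mathbf{x}^\gamma$ is the inversion (monomial) factor of $F$. Graph. For $F$ in degree $2$, the graph $G_F$ has vertices $x_1,\ldots,x_n$, an edge joining $x_i$ and $x_j$ for each $x_ix_j\in F$ ($i\ne j$) and a loop at $x_i$ for each $x_i^2\in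 F$. For a Cremona set in degree $2$ satisfying the canonical restrictions, $G_F$ is connected and is either a loopless graph with a unique circuit, which has odd length $r\ge 3$, or a tree plus exactly one loop (then put $r=1$). The root circuit is that unique circuit, or the loop with its vertex, respectively. The $j$th neighborhood of the root circuit consists of the vertices at distance $j$ from it (together with the edges joining them to vertices at distance $j-1$). Normal form. The normal form $\mathcal{N}_F$ is the log-matrix of $F$ for the following orderings of variables and monomials. The first $r$ vertices $x_1,\ldots,x_r$ are those of the root circuit, in circuit order, and the first $r$ monomials are $x_1x_2,\,x_2x_3,\ldots,x_{r-1}x_r,\,x_rx_1$ (the single monomial $x_1^2$ if $r=1$). Then come the vertices of the first neighborhood, the second neighborhood, and so on, with arbitrary order inside each neighborhood. For $i>r$ the $i$th monomial is the edge $x_{i'}x_i$ joining $x_i$ to the unique vertex $x_{i'}$ adjacent to it in the preceding neighborhood (or in the root circuit if $x_i$ is in the first neighborhood). In the theorem, $A_{F^{-1}}$ is taken with respect to $A_F=\mathcal{N}_F$. *)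

theory Defs
  imports "HOL-Library.Poly_Mapping" "HOL-Library.Cardinality" "Jordan_Normal_Form.Matrix"
begin

text \<open>
  The variables are indexed by a finite type \<open>'n\<close>, so that n is \<open>CARD('n)\<close>. A monomial is its
  exponent vector; products of monomials are therefore sums, and the unit monomial is \<open>0\<close>.
  A total order on the variables only enters through an explicit enumeration
  \<open>x :: nat \<Rightarrow> 'n\<close> of them, used on the indices \<open>{..<CARD('n)}\<close>; hence indices start at 0.
\<close>

type_synonym 'n mono = "'n \<Rightarrow>\<^sub>0 nat"
type_synonym ('n, 'k) mpol = "'n mono \<Rightarrow>\<^sub>0 'k"

definition var :: "'n \<Rightarrow> 'n mono" where
  "var i = Poly_Mapping.single i 1"

definition mdeg :: "'n::finite mono \<Rightarrow> nat" where
  "mdeg m = (\<Sum>i\<in>UNIV. Poly_Mapping.lookup m i)"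

definition mono_dvd :: "'n mono \<Rightarrow> 'n mono \<Rightarrow> bool" where
  "mono_dvd u m \<longleftrightarrow> (\<exists>w. m = u + w)"

definition squarefree_mono :: "'n mono \<Rightarrow> bool" where
  "squarefree_mono m \<longleftrightarrow> (\<forall>i. Poly_Mapping.lookup m i \<le> 1)"

definition canonical_restrictions :: "'n mono set \<Rightarrow> bool" where
  "canonical_restrictions F \<longleftrightarrow>
     (\<forall>u. (\<forall>m\<in>F. mono_dvd u m) \<longrightarrow> u = 0) \<and> (\<forall>i. \<exists>m\<in>F. mono_dvd (var i) m)"

definition common_degree :: "'n::finite mono set \<Rightarrow> nat" where
  "common_degree F = (THE d. \<forall>m\<in>F. mdeg m = d)"


section \<open>Rational self-maps of projective space\<close>

definition homogeneous :: "nat \<Rightarrow> ('n::finite, 'k::zero) mpol \<Rightarrow> bool" where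
  "homogeneous d p \<longleftrightarrow> (\<forall>m\<in>Poly_Mapping.keys p. mdeg m = d)"

definition X :: "'n \<Rightarrow> ('n, 'k::zero_neq_one) mpol" where
  "X i = Poly_Mapping.single (var i) 1"

definition subst_mpol :: "('n::finite, 'k::comm_ring_1) mpol \<Rightarrow> ('n \<Rightarrow> ('n, 'k) mpol) \<Rightarrow> ('n, 'k) mpol" where
  "subst_mpol p q =
     (\<Sum>m\<in>Poly_Mapping.keys p.
        Poly_Mapping.single 0 (Poly_Mapping.lookup p m) * (\<Prod>i\<in>UNIV. q i ^ Poly_Mapping.lookup m i))"

text \<open>
  A rational map from projective (n-1)-space over \<open>'k\<close> to itself is represented by a tuple of
  forms of one and the same degree, not all zero; two such tuples represent the same map iff they
  are proportional, i.e. iff their \<open>2 \<times> 2\<close> minors vanish. The composite of two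
  representatives is a representative exactly if substitution does not give the zero tuple.
  All of this is formulated with polynomials rather than with points, since \<open>'k\<close> may be finite.
\<close>

definition rational_map :: "('n::finite \<Rightarrow> ('n, 'k::field) mpol) \<Rightarrow> bool" where
  "rational_map p \<longleftrightarrow> (\<exists>d. \<forall>i. homogeneous d (p i)) \<and> (\<exists>i. p i \<noteq> 0)"

definition same_rational_map :: "('n \<Rightarrow> ('n, 'k::field) mpol) \<Rightarrow> ('n \<Rightarrow> ('n, 'k) mpol) \<Rightarrow> bool" where
  "same_rational_map p q \<longleftrightarrow> (\<forall>i j. p i * q j = p j * q i)"

definition compose_map ::
  "('n::finite \<Rightarrow> ('n, 'k::field) mpol) \<Rightarrow> ('n \<Rightarrow> ('n, 'k) mpol) \<Rightarrow> 'n \<Rightarrow> ('n, 'k) mpol" where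
  "compose_map q p = (\<lambda>i. subst_mpol (q i) p)"

definition birational :: "('n::finite \<Rightarrow> ('n, 'k::field) mpol) \<Rightarrow> bool" where
  "birational p \<longleftrightarrow> rational_map p \<and>
     (\<exists>q. rational_map q \<and>
          rational_map (compose_map q p) \<and> same_rational_map (compose_map q p) X \<and>
          rational_map (compose_map p q) \<and> same_rational_map (compose_map p q) X)"

text \<open>
  The enumeration of the target coordinates is irrelevant, as permuting them is an automorphism.
\<close>

definition cremona_set :: "'k::field itself \<Rightarrow> 'n::finite mono set \<Rightarrow> bool" where
  "cremona_set K F \<longleftrightarrow> card F = CARD('n) \<and>
     (\<exists>f. bij_betw f UNIV F \<and> birational (\<lambda>i. Poly_Mapping.single (f i) 1 :: ('n, 'k) mpol))"


section \<open>Log-matrices and the Cremona inverse\<close>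

definition log_matrix :: "(nat \<Rightarrow> 'n::finite) \<Rightarrow> (nat \<Rightarrow> 'n mono) \<Rightarrow> nat mat" where
  "log_matrix x f = mat CARD('n) CARD('n) (\<lambda>(i, j). Poly_Mapping.lookup (f j) (x i))"

text \<open>
  \<open>G\<close> is the inverse set, \<open>B\<close> its log-matrix and \<open>\<gamma>\<close> the inversion factor, for the set of monomials
  enumerated by \<open>f\<close> and the variables enumerated by \<open>x\<close>. The j-th variable of the monomials in
  \<open>G\<close> stands for the j-th monomial of \<open>f\<close>.
\<close>

definition is_cremona_inverse ::
  "(nat \<Rightarrow> 'n::finite) \<Rightarrow> (nat \<Rightarrow> 'n mono) \<Rightarrow> 'n mono set \<Rightarrow> nat mat \<Rightarrow> 'n mono \<Rightarrow> bool" where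
  "is_cremona_inverse x f G B \<gamma> \<longleftrightarrow>
     (\<exists>g. bij_betw g {..<CARD('n)} G \<and> B = log_matrix x g) \<and>
     (\<exists>d. \<forall>m\<in>G. mdeg m = d) \<and>
     canonical_restrictions G \<and>
     log_matrix x f * B =
       mat CARD('n) CARD('n) (\<lambda>(i, j). Poly_Mapping.lookup \<gamma> (x i)) + 1\<^sub>m CARD('n)"

definition cremona_inverse ::
  "(nat \<Rightarrow> 'n::finite) \<Rightarrow> (nat \<Rightarrow> 'n mono) \<Rightarrow> 'n mono set \<times> nat mat \<times> 'n mono" where
  "cremona_inverse x f = (THE (G, B, \<gamma>). is_cremona_inverse x f G B \<gamma>)"


section \<open>The graph of a set of monomials of degree 2\<close>

text \<open>
  A graph is given by its set of edges, its vertices being all of \<open>'n\<close>. An edge is the set of its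
  endpoints, a loop at \<open>i\<close> being the singleton \<open>{i}\<close>; so the edge of a monomial of degree 2 is the
  set \<open>keys\<close> of variables occurring in it.
\<close>

definition graph :: "'n mono set \<Rightarrow> 'n set set" where
  "graph F = {{i, j} | i j. var i + var j \<in> F}"

text \<open>Loops count twice.\<close>

definition vdegree :: "'n set set \<Rightarrow> 'n \<Rightarrow> nat" where
  "vdegree E v = card {e \<in> E. v \<in> e} + card {e \<in> E. e = {v}}"

definition circuit_edges :: "'n list \<Rightarrow> 'n set set" where
  "circuit_edges c = {{c ! i, c ! (Suc i mod length c)} | i. i < length c}"

text \<open>
  Length 1 is a loop with its vertex. Length 2 is excluded because it would traverse an edge back
  and forth.
\<close>

definition is_circuit :: "'n set set \<Rightarrow> 'n list \<Rightarrow> bool" where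
  "is_circuit E c \<longleftrightarrow>
     c \<noteq> [] \<and> length c \<noteq> 2 \<and> distinct c \<and> circuit_edges c \<subseteq> E"

text \<open>The unique circuit, as a pair of its vertex set and its edge set.\<close>

definition root_circuit :: "'n set set \<Rightarrow> 'n set \<times> 'n set set" where
  "root_circuit E = (THE H. \<exists>c. is_circuit E c \<and> H = (set c, circuit_edges c))"

abbreviation root_verts :: "'n set set \<Rightarrow> 'n set" where
  "root_verts E \<equiv> fst (root_circuit E)"

abbreviation root_edges :: "'n set set \<Rightarrow> 'n set set" where
  "root_edges E \<equiv> snd (root_circuit E)"

definition adjacency :: "'n set set \<Rightarrow> ('n \<times> 'n) set" where
  "adjacency E = {(u, v). {u, v} \<in> E}"

text \<open>The vertices at distance \<open>j\<close> from the root circuit.\<close>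

definition neighborhood :: "'n set set \<Rightarrow> nat \<Rightarrow> 'n set" where
  "neighborhood E j =
     {v. (\<exists>c\<in>root_verts E. (c, v) \<in> adjacency E ^^ j) \<and>
         (\<forall>k<j. \<forall>c\<in>root_verts E. (c, v) \<notin> adjacency E ^^ k)}"

text \<open>The edges left after omitting the vertices of degree 1.\<close>

definition pruned :: "'n set set \<Rightarrow> 'n set set" where
  "pruned E = {e \<in> E. \<forall>v\<in>e. vdegree E v \<noteq> 1}"

text \<open>
  The log-matrix \<open>log_matrix x f\<close> is in normal form: \<open>x\<close> and \<open>f\<close> enumerate the variables and the
  monomials in the prescribed way.
\<close>

definition normal_form :: "'n::finite mono set \<Rightarrow> (nat \<Rightarrow> 'n) \<Rightarrow> (nat \<Rightarrow> 'n mono) \<Rightarrow> bool" where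
  "normal_form F x f \<longleftrightarrow>
     (let E = graph F; r = card (root_verts E) in
        bij_betw x {..<CARD('n)} UNIV \<and> bij_betw f {..<CARD('n)} F \<and>
        is_circuit E (map x [0..<r]) \<and>
        root_circuit E = (x ` {..<r}, circuit_edges (map x [0..<r])) \<and>
        (\<forall>i<r. f i = var (x i) + var (x (Suc i mod r))) \<and>
        (\<forall>i j p q. r \<le> i \<and> i < j \<and> j < CARD('n) \<and>
             x i \<in> neighborhood E p \<and> x j \<in> neighborhood E q \<longrightarrow> p \<le> q) \<and>
        (\<forall>i. r \<le> i \<and> i < CARD('n) \<longrightarrow>
             (\<exists>p u. x i \<in> neighborhood E (Suc p) \<and>
                    {w \<in> neighborhood E p. {w, x i} \<in> E} = {u} \<and>
                    f i = var u + var (x i))))"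

end

theory Submission
  imports Defs
begin

text \<open>
  Linear algebra on a weighted graph carries the proof. A column \<open>b\<close> of the inverse matrix is a
  weighting of the edges of the graph, and the log-matrix sends it to its boundary, the vector of
  sums of weights at the vertices, a loop counting twice. The defining equation of the inverse says
  that the j-th column has boundary \<open>\<gamma> + e\<^sub>j\<close>, where \<open>e\<^sub>j\<close> is the j-th unit vector. In normal
  form every vertex \<open>i\<close> off the circuit has a parent \<open>par i < i\<close>, and its edge joins it to that
  parent; so everything can be decided by climbing towards the circuit.

  The circuit is odd. Otherwise the graph is bipartite, and the vertex weight \<open>\<plusminus>1\<close> given by the two
  colours is orthogonal to all monomials of \<open>F\<close>. Every monomial that occurs when \<open>F\<close>
  is substituted into a form then has weight 0, so the composite of \<open>F\<close> with a candidate inverse cannot be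
  proportional to the variables, whose weights differ (\<open>cremona_set_weight_constant\<close>,
  \<open>cremona_odd\<close>). The argument looks only at the monomials that occur, hence is valid over
  every field.

  On an odd circuit the equations can be solved over the rationals. The weighting that is \<open>1/2\<close> on
  circuit edges, \<open>1\<close> on edges above an inner vertex (a vertex off the circuit of degree at least 2)
  and \<open>0\<close> on edges above a leaf has boundary \<open>\<gamma>\<close>, namely one at each vertex of the circuit plus the
  endpoints of the edges above inner vertices. The vector \<open>e\<^sub>j\<close> is the boundary of the weighting with values \<open>\<plusminus>1\<close>,
  alternating along the path from \<open>j\<close> down to the circuit, and \<open>\<plusminus>1/2\<close> alternating around it. Adding
  the two gives entries in \<open>{0, 1}\<close> on the circuit, in \<open>{0, 1, 2}\<close> above inner vertices, where the
  diagonal entry is 2 and the entry of any child is 0, and \<open>e\<^sub>j\<close> itself above leaves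
  (\<open>boundary_entry\<close>, \<open>entry_range\<close>, \<open>entry_two_iff\<close>). Summing boundaries counts
  each edge twice, which gives the degree (\<open>entry_column_sum\<close>).

  Uniqueness, without which the inverse would not denote this matrix, holds because the boundary
  map is injective: a weighting with boundary 0 vanishes on the tree edges, from the leaves inwards,
  and then alternates around a circuit of odd length, so vanishes there too
  (\<open>boundary_inj\<close>). Two solutions thus differ by a vector that is the same for all columns,
  and it is zero as every row of either solution contains a 0.
\<close>

section \<open>Weightings of a rooted unicyclic graph\<close>

text \<open>
  Vertices and edges are both numbered by \<open>{..<n}\<close>. The vertices below \<open>r\<close> form the circuit, and
  edge \<open>i < r\<close> joins \<open>i\<close> to its successor; for \<open>i \<ge> r\<close>, edge \<open>i\<close> joins vertex \<open>i\<close> to its parent. As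
  \<open>par\<close> decreases, recursion towards the circuit is well-founded.
\<close>

locale rooted_unicyclic =
  fixes n r :: nat and par :: "nat \<Rightarrow> nat"
  assumes r_pos: "0 < r" and r_le: "r \<le> n"
    and par_less: "r \<le> i \<Longrightarrow> i < n \<Longrightarrow> par i < i"
begin

text \<open>
  A value at every vertex, obtained from given values on the circuit by stepping from parent to
  child. The guard is the range in which \<open>par\<close> is known to decrease.
\<close>

function climb :: "(nat \<Rightarrow> 'a) \<Rightarrow> (nat \<Rightarrow> 'a \<Rightarrow> 'a) \<Rightarrow> nat \<Rightarrow> 'a" where
  "climb base step j =
     (if r \<le> j \<and> j < n then step j (climb base step (par j)) else base j)"
  by pat_completeness auto
termination by (relation "measure (\<lambda>(_, _, j). j)") (auto simp: par_less)

declare climb.simps [simp del]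

lemma climb_root: "j < r \<Longrightarrow> climb base step j = base j"
  by (simp add: climb.simps)

lemma climb_child:
  "r \<le> j \<Longrightarrow> j < n \<Longrightarrow> climb base step j = step j (climb base step (par j))"
  by (simp add: climb.simps[of base step j])

text \<open>
  The two summands of an edge coincide for a loop (\<open>r = 1\<close>), giving the entry 2 as in the log-matrix.
\<close>

definition incid :: "nat \<Rightarrow> nat \<Rightarrow> int" where
  "incid v i = (if i < r then of_bool (v = i) + of_bool (v = Suc i mod r)
                else of_bool (v = par i) + of_bool (v = i))"

definition inner :: "nat \<Rightarrow> bool" where
  "inner i \<longleftrightarrow> r \<le> i \<and> (\<exists>k. r \<le> k \<and> k < n \<and> par k = i)"

lemma inner_less: "inner i \<Longrightarrow> i < n"
  unfolding inner_def using par_less by (metis less_trans)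

lemma inner_par: "r \<le> j \<Longrightarrow> j < n \<Longrightarrow> r \<le> par j \<Longrightarrow> inner (par j)"
  unfolding inner_def by blast

definition boundary :: "(nat \<Rightarrow> int) \<Rightarrow> nat \<Rightarrow> int" where
  "boundary b v = (\<Sum>i<n. incid v i * b i)"

lemma boundary_add: "boundary (\<lambda>i. b i + c i) v = boundary b v + boundary c v"
  by (simp add: boundary_def algebra_simps sum.distrib)

lemma boundary_diff: "boundary (\<lambda>i. b i - c i) v = boundary b v - boundary c v"
  by (simp add: boundary_def algebra_simps sum_subtractf)

lemma boundary_scale: "boundary (\<lambda>i. a * b i) v = a * boundary b v"
  by (simp add: boundary_def algebra_simps sum_distrib_left)

lemma boundary_single: "j < n \<Longrightarrow> boundary (\<lambda>i. of_bool (i = j)) v = incid v j"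
  by (simp add: boundary_def of_bool_def if_distrib sum.delta cong: if_cong)

lemma boundary_split:
  "boundary b v = boundary (\<lambda>i. of_bool (i < r) * b i) v + boundary (\<lambda>i. of_bool (r \<le> i) * b i) v"
  unfolding boundary_add[symmetric] by (rule arg_cong[where f="\<lambda>b. boundary b v"]) (auto simp: fun_eq_iff)

lemma boundary_circuit:
  assumes "v < r"
  shows "boundary (\<lambda>i. of_bool (i < r) * b i) v = b v + b (if v = 0 then r - 1 else v - 1)"
proof -
  let ?p = "if v = 0 then r - 1 else v - 1"
  have *: "v = Suc i mod r \<longleftrightarrow> i = ?p" if "i < r" for i
    using that assms by (cases "Suc i = r") auto
  have "boundary (\<lambda>i. of_bool (i < r) * b i) v
      = (\<Sum>i<r. (of_bool (v = i) + of_bool (v = Suc i mod r)) * b i)"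
    unfolding boundary_def incid_def using r_le
    by (intro sum.mono_neutral_cong_right) auto
  also have "\<dots> = (\<Sum>i<r. (if i = v then b i else 0) + (if i = ?p then b i else 0))"
    by (rule sum.cong) (auto simp: *)
  also have "\<dots> = b v + b ?p"
    unfolding sum.distrib using assms by (auto simp: sum.delta)
  finally show ?thesis .
qed

lemma boundary_circuit_off:
  assumes "r \<le> v"
  shows "boundary (\<lambda>i. of_bool (i < r) * b i) v = 0"
  unfolding boundary_def
proof (rule sum.neutral, safe)
  fix i
  have "Suc i mod r < r" using r_pos by simp
  then show "incid v i * (of_bool (i < r) * b i) = 0"
    using assms by (auto simp: incid_def)
qed

end

locale odd_rooted_unicyclic = rooted_unicyclic +
  assumes odd_r: "odd r" and n_ge_2: "2 \<le> n"
begin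

text \<open>
  Leaf elimination, organised by descending index: at vertex \<open>i\<close> off the circuit only edge \<open>i\<close> and
  the edges to its children meet, and the latter have larger indices. What remains lives on
  the circuit and alternates, which the odd length forbids.
\<close>

lemma boundary_inj:
  assumes zero: "\<And>v. v < n \<Longrightarrow> boundary b v = 0" and "i < n"
  shows "b i = 0"
proof -
  have off: "b i = 0" if "r \<le> i" "i < n" for i
    using that
  proof (induction "n - i" arbitrary: i rule: less_induct)
    case less
    have "boundary b i = (\<Sum>j<n. if j = i then b i else 0)"
      unfolding boundary_def
    proof (rule sum.cong)
      fix j assume "j \<in> {..<n}"
      then have j: "j < n" by simp
      consider "j < r" | "r \<le> j" "par j = i" | "r \<le> j" "par j \<noteq> i" by linarith
      then show "incid i j * b j = (if j = i then b i else 0)"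
      proof cases
        case 1
        have "Suc j mod r < r" using r_pos by simp
        then have "\<not> i = Suc j mod r" using less.prems(1) by (metis not_le)
        then show ?thesis using 1 less.prems(1) by (simp add: incid_def)
      next
        case 2
        then have "i < j" using par_less j by blast
        then have "b j = 0" using less.hyps[of j] 2 j less.prems by simp
        then show ?thesis using \<open>i < j\<close> by simp
      next
        case 3
        then show ?thesis by (auto simp: incid_def)
      qed
    qed simp
    also have "\<dots> = b i" using less.prems by simp
    finally show ?case using zero less.prems by simp
  qed
  have "boundary (\<lambda>i. of_bool (r \<le> i) * b i) v = 0" for v
    unfolding boundary_def by (rule sum.neutral) (auto simp: off)
  then have step: "b v + b (if v = 0 then r - 1 else v - 1) = 0" if "v < r" for v
    using boundary_split[of b v] boundary_circuit[OF that, of b] zero[of v] that r_le by simp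
  have alt: "b v = (- 1) ^ v * b 0" if "v < r" for v
    using that
  proof (induction v)
    case (Suc v)
    then show ?case using step[of "Suc v"] by simp
  qed simp
  have "b (r - 1) = b 0" using alt[of "r - 1"] odd_r r_pos by simp
  then have "b 0 = 0" using step[of 0] r_pos by simp
  then show ?thesis using alt[of i] off[of i] \<open>i < n\<close> by (cases "i < r") auto
qed

text \<open>
  Twice the rational weighting with boundary \<open>\<gamma>\<close>. For \<open>j\<close> off the circuit, the weighting that is 1 on edge
  \<open>j\<close> alone has as boundary the sum of the unit vectors at \<open>j\<close> and at its parent. Hence the columns of the inverse matrix
  at \<open>j\<close> and at \<open>par j\<close> add up to this weighting plus the one on edge \<open>j\<close>.
\<close>

definition double_base :: "nat \<Rightarrow> int" where
  "double_base i = of_bool (i < r) + 2 * of_bool (inner i)"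

text \<open>
  The column at a child follows from the column at its parent by that relation, with no
  fractions involved. For a circuit vertex \<open>j\<close>, edge \<open>j + k\<close> (indices modulo \<open>r\<close>, \<open>0 \<le> k < r\<close>) carries
  \<open>1/2 + (-1)\<^sup>k/2\<close>. As \<open>r\<close> is odd, \<open>k\<close> has the parity of \<open>i - j\<close> if \<open>j \<le> i\<close> and the opposite one if
  the numbering wraps around, whence the equivalence in the formula.
\<close>

definition entry :: "nat \<Rightarrow> nat \<Rightarrow> int" where
  "entry i = climb (\<lambda>j. if i < r then of_bool (even (i + j) \<longleftrightarrow> j \<le> i) else of_bool (inner i))
                   (\<lambda>j e. double_base i + of_bool (i = j) - e)"

lemma entry_root:
  "j < r \<Longrightarrow> entry i j = (if i < r then of_bool (even (i + j) \<longleftrightarrow> j \<le> i) else of_bool (inner i))"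
  by (simp add: entry_def climb_root)

lemma entry_child:
  "r \<le> j \<Longrightarrow> j < n \<Longrightarrow> entry i j = double_base i + of_bool (i = j) - entry i (par j)"
  unfolding entry_def by (rule climb_child)

text \<open>
  The exponents of the inversion factor: the edges above inner vertices are those that remain off the
  circuit when the leaves are omitted, and a boundary collects the exponents of their product.
\<close>

definition factor :: "nat \<Rightarrow> int" where
  "factor v = of_bool (v < r) + boundary (\<lambda>i. of_bool (inner i)) v"

lemma boundary_double_base: "v < n \<Longrightarrow> boundary double_base v = 2 * factor v"
proof -
  have "boundary double_base v
      = boundary (\<lambda>i. of_bool (i < r) * 1) v + 2 * boundary (\<lambda>i. of_bool (inner i)) v"
    unfolding boundary_scale[symmetric] boundary_add[symmetric]
    by (rule arg_cong[where f="\<lambda>b. boundary b v"]) (auto simp: fun_eq_iff double_base_def)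
  also have "boundary (\<lambda>i. of_bool (i < r) * 1) v = 2 * of_bool (v < r)"
    by (cases "v < r") (simp_all only: boundary_circuit boundary_circuit_off not_less, simp_all)
  finally show ?thesis by (simp add: factor_def)
qed

text \<open>
  Induction up the tree: for \<open>j\<close> off the circuit the boundary is
  \<open>2\<gamma> + (e\<^sub>j + e\<^sub>p) - (\<gamma> + e\<^sub>p) = \<gamma> + e\<^sub>j\<close> with \<open>p = par j\<close>. At a circuit vertex, the two circuit edges carry 0 and 1,
  except at \<open>j\<close>, where both carry 1 (for a loop, one edge counted twice).
\<close>

lemma boundary_entry:
  assumes "j < n" "v < n"
  shows "boundary (\<lambda>i. entry i j) v = factor v + of_bool (v = j)"
  using \<open>j < n\<close>
proof (induction j rule: less_induct)
  case (less j)
  show ?case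
  proof (cases "j < r")
    case True
    let ?c = "\<lambda>i. of_bool (even (i + j) \<longleftrightarrow> j \<le> i) :: int"
    have "boundary (\<lambda>i. of_bool (r \<le> i) * entry i j) v = boundary (\<lambda>i. of_bool (inner i)) v"
      by (rule arg_cong[where f="\<lambda>b. boundary b v"])
         (auto simp: fun_eq_iff entry_root True inner_def)
    moreover have "boundary (\<lambda>i. of_bool (i < r) * entry i j) v = of_bool (v < r) + of_bool (v = j)"
    proof (cases "v < r")
      case v: True
      have "boundary (\<lambda>i. of_bool (i < r) * entry i j) v
          = ?c v + ?c (if v = 0 then r - 1 else v - 1)"
        using v True by (simp add: boundary_circuit entry_root less_imp_diff_less)
      also have "\<dots> = 1 + of_bool (v = j)"
      proof (cases v)
        case 0
        then show ?thesis using odd_r True by (auto simp: of_bool_def)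
      next
        case (Suc w)
        then show ?thesis by (auto simp: of_bool_def)
      qed
      finally show ?thesis using v by simp
    next
      case False
      then show ?thesis using boundary_circuit_off[of v] True by simp
    qed
    ultimately show ?thesis
      using boundary_split[of "\<lambda>i. entry i j" v] by (simp add: factor_def)
  next
    case False
    then have j: "r \<le> j" "par j < j" using par_less less.prems by auto
    have "boundary (\<lambda>i. entry i j) v
        = boundary double_base v + boundary (\<lambda>i. of_bool (i = j)) v - boundary (\<lambda>i. entry i (par j)) v"
      using entry_child[OF j(1) less.prems] by (simp add: boundary_add boundary_diff)
    also have "\<dots> = 2 * factor v + incid v j - (factor v + of_bool (v = par j))"
      using less.IH[OF j(2)] j less.prems \<open>v < n\<close> by (simp add: boundary_double_base boundary_single)
    also have "\<dots> = factor v + of_bool (v = j)"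
      using j by (simp add: incid_def)
    finally show ?thesis .
  qed
qed

text \<open>
  Along a path upwards, the entries of a circuit row alternate between \<open>e\<close> and \<open>1 - e\<close>.
\<close>

lemma entry_circuit_range:
  assumes "i < r" "j < n"
  shows "entry i j \<in> {0, 1}"
  using \<open>j < n\<close>
proof (induction j rule: less_induct)
  case (less j)
  show ?case
  proof (cases "j < r")
    case False
    then have "entry i (par j) \<in> {0, 1}" using less par_less[of j] by simp
    then show ?thesis using False less.prems assms
      by (auto simp: entry_child double_base_def inner_def)
  qed (simp add: entry_root of_bool_def)
qed

text \<open>
  The path from \<open>j\<close> to the circuit uses the edge above a leaf only if \<open>j\<close> is that leaf.
\<close>

lemma entry_leaf:
  assumes "r \<le> i" "\<not> inner i" "j < n"
  shows "entry i j = of_bool (i = j)"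
  using \<open>j < n\<close>
proof (induction j rule: less_induct)
  case (less j)
  show ?case
  proof (cases "j < r")
    case False
    then have "entry i (par j) = of_bool (i = par j)" using less par_less[of j] by simp
    moreover have "i \<noteq> par j" using assms False less.prems by (auto simp: inner_def)
    ultimately show ?thesis using False less.prems assms
      by (auto simp: entry_child double_base_def)
  qed (use assms in \<open>auto simp: entry_root\<close>)
qed

text \<open>
  A path from \<open>j < i\<close> descends through smaller indices, so it avoids edge \<open>i\<close> and leaves the base
  weight 1 unchanged.
\<close>

lemma entry_inner_earlier:
  assumes "inner i" "j < i"
  shows "entry i j = 1"
  using \<open>j < i\<close>
proof (induction j rule: less_induct)
  case (less j)
  have i: "r \<le> i" "i < n" using assms inner_def inner_less by auto
  show ?case
  proof (cases "j < r")
    case False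
    then have "entry i (par j) = 1" using less par_less[of j] i by simp
    then show ?thesis using False less.prems assms i
      by (auto simp: entry_child double_base_def)
  qed (use assms i in \<open>auto simp: entry_root\<close>)
qed

lemma entry_inner_diag: "inner i \<Longrightarrow> entry i i = 2"
proof -
  assume "inner i"
  then have i: "r \<le> i" "i < n" using inner_def inner_less by auto
  then show ?thesis
    using entry_inner_earlier[OF \<open>inner i\<close> par_less[OF i]] \<open>inner i\<close>
    by (simp add: entry_child double_base_def)
qed

lemma entry_inner_range:
  assumes "inner i" "j < n"
  shows "entry i j \<in> {0, 1, 2}"
  using \<open>j < n\<close>
proof (induction j rule: less_induct)
  case (less j)
  have i: "r \<le> i" "i < n" using assms inner_def inner_less by auto
  consider "j < i" | "j = i" | "i < j" by linarith
  then show ?case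
  proof cases
    case 3
    then have "entry i (par j) \<in> {0, 1, 2}" using less par_less[of j] i by simp
    then show ?thesis using 3 less.prems assms i
      by (auto simp: entry_child double_base_def)
  qed (use assms in \<open>auto simp: entry_inner_earlier entry_inner_diag\<close>)
qed

lemma entry_range: "i < n \<Longrightarrow> j < n \<Longrightarrow> entry i j \<in> {0, 1, 2}"
  using entry_circuit_range[of i j] entry_leaf[of i j] entry_inner_range[of i j]
  by (cases "i < r"; cases "inner i") auto

lemma entry_two_iff:
  assumes "i < n"
  shows "(\<exists>j<n. entry i j = 2) \<longleftrightarrow> inner i"
proof
  assume "\<exists>j<n. entry i j = 2"
  then obtain j where j: "j < n" "entry i j = 2" by blast
  have "r \<le> i" using entry_circuit_range[of i j] j by fastforce
  moreover have False if "\<not> inner i" "r \<le> i"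
    using entry_leaf[OF that(2,1) j(1)] j(2) by (simp add: of_bool_def split: if_splits)
  ultimately show "inner i" by blast
next
  assume "inner i"
  then show "\<exists>j<n. entry i j = 2" using entry_inner_diag assms by blast
qed

lemma entry_diag_nonzero: "i < n \<Longrightarrow> entry i i \<noteq> 0"
  using entry_root[of i i] entry_leaf[of i i] entry_inner_diag[of i]
  by (cases "i < r"; cases "inner i") auto

text \<open>
  This says that the inverse monomials have no common factor. On the circuit the zero
  is found at the preceding vertex; for a loop, at any vertex adjacent to it, and vertex 1 is one;
  above an inner vertex, at any of its children.
\<close>

lemma entry_zero:
  assumes "i < n"
  shows "\<exists>j<n. entry i j = 0"
proof -
  consider "0 < i" "i < r" | "i = 0" "1 < r" | "i = 0" "r = 1" | "inner i"
    | "r \<le> i" "\<not> inner i" using r_pos by linarith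
  then show ?thesis
  proof cases
    case 1
    then have "entry i (i - 1) = 0" by (subst entry_root) (auto simp: of_bool_def)
    then show ?thesis using assms by (intro exI[of _ "i - 1"]) auto
  next
    case 2
    then have "entry i (r - 1) = 0" using odd_r by (subst entry_root) (auto simp: of_bool_def)
    then show ?thesis using r_le r_pos by (intro exI[of _ "r - 1"]) auto
  next
    case 3
    have "par 1 = 0" using par_less[of 1] 3 n_ge_2 by simp
    moreover have "entry 0 0 = 1" "double_base 0 = 1"
      using r_pos by (simp_all add: entry_root double_base_def inner_def)
    moreover have "entry 0 1 = double_base 0 - entry 0 (par 1)"
      using 3(2) n_ge_2 entry_child[of 1 0] by auto
    ultimately have "entry i 1 = 0" using 3(1) by simp
    then show ?thesis using n_ge_2 by (intro exI[of _ 1]) auto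
  next
    case 4
    then obtain k where k: "r \<le> k" "k < n" "par k = i" by (auto simp: inner_def)
    have "entry i k = double_base i + of_bool (i = k) - entry i i"
      using entry_child[OF k(1,2), of i] k(3) by simp
    then have "entry i k = 0"
      using 4 k par_less[OF k(1,2)] by (auto simp: entry_inner_diag double_base_def inner_def)
    then show ?thesis using k by blast
  next
    case 5
    have "\<exists>j<n. j \<noteq> i" using n_ge_2 by (intro exI[of _ "if i = 0 then 1 else 0"]) auto
    then show ?thesis using 5 entry_leaf by auto
  qed
qed

lemma incid_column_sum:
  assumes "i < n"
  shows "(\<Sum>v<n. incid v i) = 2"
proof -
  have "Suc i mod r < n" using r_pos r_le by (meson mod_less_divisor less_le_trans)
  moreover have "par i < n" if "r \<le> i" using par_less[of i] assms that by simp
  moreover have "(\<Sum>v<n. of_bool (v = a) :: int) = 1" if "a < n" for a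
    using that by (simp add: of_bool_def)
  ultimately show ?thesis using assms
    by (cases "i < r") (simp_all add: incid_def sum.distrib)
qed

text \<open>
  Each edge has two ends.
\<close>

lemma boundary_total: "(\<Sum>v<n. boundary b v) = 2 * (\<Sum>i<n. b i)"
proof -
  have "(\<Sum>v<n. boundary b v) = (\<Sum>i<n. \<Sum>v<n. incid v i * b i)"
    unfolding boundary_def by (rule sum.swap)
  also have "\<dots> = (\<Sum>i<n. 2 * b i)"
    by (simp add: sum_distrib_right[symmetric] incid_column_sum)
  finally show ?thesis by (simp add: sum_distrib_left)
qed

lemma entry_column_sum:
  assumes "j < n"
  shows "2 * (\<Sum>i<n. entry i j) = int r + 1 + 2 * int (card {i. inner i})"
proof -
  have "2 * (\<Sum>i<n. entry i j) = (\<Sum>v<n. factor v) + 1"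
    unfolding boundary_total[symmetric] using assms
    by (simp add: boundary_entry sum.distrib of_bool_def)
  also have "(\<Sum>v<n. factor v) = (\<Sum>v<n. of_bool (v < r)) + 2 * (\<Sum>i<n. of_bool (inner i))"
    by (simp add: factor_def sum.distrib boundary_total)
  also have "(\<Sum>v<n. of_bool (v < r) :: int) = int r"
  proof -
    have "{..<n} \<inter> {v. v < r} = {..<r}" using r_le by auto
    then show ?thesis by (simp)
  qed
  also have "(\<Sum>i<n. of_bool (inner i) :: int) = int (card {i. inner i})"
  proof -
    have "{..<n} \<inter> {i. inner i} = {i. inner i}" using inner_less by auto
    then show ?thesis by simp
  qed
  finally show ?thesis by simp
qed

end

section \<open>Monomials and weights\<close>

lemma lookup_var: "Poly_Mapping.lookup (var i) k = of_bool (k = i)"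
  by (simp add: var_def lookup_single when_def)

lemma mono_dvd_iff: "mono_dvd u m \<longleftrightarrow> (\<forall>k. Poly_Mapping.lookup u k \<le> Poly_Mapping.lookup m k)"
proof
  assume "\<forall>k. Poly_Mapping.lookup u k \<le> Poly_Mapping.lookup m k"
  then have "m = u + (m - u)" by (intro poly_mapping_eqI) (simp add: lookup_add lookup_minus)
  then show "mono_dvd u m" unfolding mono_dvd_def by blast
qed (auto simp: mono_dvd_def lookup_add)

lemma mono_dvd_var_iff: "mono_dvd (var i) m \<longleftrightarrow> Poly_Mapping.lookup m i \<noteq> 0"
  by (auto simp: mono_dvd_iff lookup_var of_bool_def)

lemma keys_var_add_var: "Poly_Mapping.keys (var i + var j) = {i, j}"
  by (auto simp: in_keys_iff lookup_add lookup_var of_bool_def split: if_splits)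

lemma mdeg_eq_2:
  fixes m :: "'n::finite mono"
  assumes "mdeg m = 2"
  obtains i j where "m = var i + var j"
proof -
  have "m \<noteq> 0" using assms by (auto simp: mdeg_def)
  then obtain i where i: "Poly_Mapping.lookup m i \<noteq> 0" by (metis poly_mapping_eqI lookup_zero)
  then obtain m' where m': "m = var i + m'" using mono_dvd_var_iff mono_dvd_def by metis
  have deg: "mdeg (u + v) = mdeg u + mdeg v" for u v :: "'n mono"
    by (simp add: mdeg_def lookup_add sum.distrib)
  have deg_var: "mdeg (var k) = 1" for k :: 'n by (simp add: mdeg_def lookup_var of_bool_def)
  have "mdeg m' = 1" using assms deg deg_var m' by simp
  then have "m' \<noteq> 0" by (auto simp: mdeg_def)
  then obtain j where j: "Poly_Mapping.lookup m' j \<noteq> 0" by (metis poly_mapping_eqI lookup_zero)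
  then obtain u where u: "m' = var j + u" using mono_dvd_var_iff mono_dvd_def by metis
  have "mdeg u = 0" using \<open>mdeg m' = 1\<close> deg deg_var u by simp
  then have "u = 0" by (intro poly_mapping_eqI) (simp add: mdeg_def)
  then show ?thesis using that m' u by simp
qed

text \<open>
  Translation by \<open>t\<close> is injective on monomials, so no two terms of the product can cancel.
\<close>

lemma keys_times_monomial:
  fixes P :: "('n, 'k::field) mpol"
  shows "Poly_Mapping.keys (P * Poly_Mapping.single t 1) = (\<lambda>m. m + t) ` Poly_Mapping.keys P"
proof -
  have shift: "Poly_Mapping.lookup (P * Poly_Mapping.single t 1) (m + t) = Poly_Mapping.lookup P m" for m
  proof -
    have "(\<Sum>q. Poly_Mapping.lookup (Poly_Mapping.single t (1 :: 'k)) q when m + t = l + q) = (1 when l = m)" for l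
    proof -
      have "(Poly_Mapping.lookup (Poly_Mapping.single t (1 :: 'k)) q when m + t = l + q)
          = ((1 when l = m) when q = t)" for q
        by (auto simp: lookup_single when_def)
      then show ?thesis by simp
    qed
    then show ?thesis
      by (simp only: lookup_mult mult_when mult_1_right Sum_any_when_equal)
  qed
  show ?thesis
  proof (intro equalityI subsetI)
    fix k assume "k \<in> Poly_Mapping.keys (P * Poly_Mapping.single t 1)"
    then show "k \<in> (\<lambda>m. m + t) ` Poly_Mapping.keys P"
      using keys_mult[of P "Poly_Mapping.single t 1"] by auto
  qed (auto simp: in_keys_iff shift)
qed

text \<open>
  The polynomials all of whose monomials have weight 0 form a subring containing the constants.
\<close>

lemma weight_subst_mpol:
  fixes w :: "'n::finite mono \<Rightarrow> int" and q :: "('n, 'k::field) mpol"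
  assumes add: "\<And>a b. w (a + b) = w a + w b"
    and p: "\<And>i. \<forall>m\<in>Poly_Mapping.keys (p i). w m = 0"
  shows "\<forall>m\<in>Poly_Mapping.keys (subst_mpol q p). w m = 0"
proof -
  define S where "S = {P :: ('n, 'k) mpol. \<forall>m\<in>Poly_Mapping.keys P. w m = 0}"
  have w0: "w 0 = 0" using add[of 0 0] by simp
  have one: "1 \<in> S" and const: "Poly_Mapping.single 0 c \<in> S" for c
    by (auto simp: S_def w0 split: if_splits)
  have mult: "P * Q \<in> S" if "P \<in> S" "Q \<in> S" for P Q
    using that keys_mult[of P Q] by (fastforce simp: S_def add)
  have power: "P ^ k \<in> S" if "P \<in> S" for P k
    using that by (induction k) (auto simp: one mult)
  have prod: "(\<Prod>i\<in>A. p i ^ e i) \<in> S" if "finite A" for A and e :: "'n \<Rightarrow> nat"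
    using that by (induction A) (auto simp: one intro!: mult power, auto simp: S_def p)
  have "subst_mpol q p \<in> S"
    unfolding subst_mpol_def S_def
    using keys_sum mult[OF const prod[OF finite]] unfolding S_def by fast
  then show ?thesis by (simp add: S_def)
qed

text \<open>
  Let \<open>Q\<close> be the composite of \<open>F\<close> with an inverse, so that \<open>Q\<^sub>a X\<^sub>b = Q\<^sub>b X\<^sub>a\<close> with some \<open>Q\<^sub>a \<noteq> 0\<close>. All
  monomials of \<open>Q\<^sub>a\<close> and \<open>Q\<^sub>b\<close> have weight 0, so comparing the weights of the monomials on both sides shows
  that \<open>X\<^sub>a\<close> and \<open>X\<^sub>b\<close> have the same weight.
\<close>

lemma cremona_set_weight_constant:
  fixes w :: "'n::finite mono \<Rightarrow> int"
  assumes cremona: "cremona_set TYPE('k::field) F"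
    and add: "\<And>a b. w (a + b) = w a + w b"
    and zero: "\<And>m. m \<in> F \<Longrightarrow> w m = 0"
  shows "w (var i) = w (var j)"
proof -
  obtain g where g: "bij_betw g UNIV F"
    and "birational (\<lambda>i. Poly_Mapping.single (g i) 1 :: ('n, 'k) mpol)" (is "birational ?p")
    using cremona unfolding cremona_set_def by blast
  then obtain q where "rational_map (compose_map q ?p)" "same_rational_map (compose_map q ?p) X"
    unfolding birational_def by blast
  then obtain a where a: "compose_map q ?p a \<noteq> 0"
    and eq: "\<And>b. compose_map q ?p a * X b = compose_map q ?p b * X a"
    unfolding rational_map_def same_rational_map_def by blast
  have w0: "\<forall>m\<in>Poly_Mapping.keys (compose_map q ?p b). w m = 0" for b
    unfolding compose_map_def using g zero
    by (intro weight_subst_mpol add) (auto simp: bij_betw_def)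
  obtain m where m: "m \<in> Poly_Mapping.keys (compose_map q ?p a)" using a by fastforce
  have "w (var b) = w (var a)" for b
  proof -
    have "m + var b \<in> Poly_Mapping.keys (compose_map q ?p b * X a)"
      unfolding eq[of b, symmetric] unfolding X_def keys_times_monomial using m by blast
    then obtain m' where "m' \<in> Poly_Mapping.keys (compose_map q ?p b)" "m + var b = m' + var a"
      unfolding X_def keys_times_monomial by blast
    then show ?thesis using w0 m add by (metis add_0)
  qed
  then show ?thesis by metis
qed

section \<open>The graph of monomials in normal form\<close>

lemma graph_eq_keys:
  assumes "\<forall>m\<in>F. mdeg m = 2"
  shows "graph F = Poly_Mapping.keys ` F"
proof -
  have "\<exists>i j. m = var i + var j" if "m \<in> F" for m
    using mdeg_eq_2[of m] assms that by metis
  then show ?thesis unfolding graph_def by (force simp: keys_var_add_var[symmetric])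
qed

text \<open>
  In degree 2 the support determines the monomial, squares being the ones with a single variable.
  So edges may be counted by the indices of their monomials.
\<close>

lemma inj_on_keys_degree_2:
  assumes "\<forall>m\<in>F. mdeg m = 2"
  shows "inj_on Poly_Mapping.keys F"
proof (rule inj_onI)
  fix m m' assume m: "m \<in> F" "m' \<in> F" and eq: "Poly_Mapping.keys m = Poly_Mapping.keys m'"
  obtain i j where ij: "m = var i + var j" using mdeg_eq_2 m assms by metis
  obtain k l where kl: "m' = var k + var l" using mdeg_eq_2 m assms by metis
  have "(k = i \<and> l = j) \<or> (k = j \<and> l = i)"
    using eq unfolding ij kl keys_var_add_var by (metis doubleton_eq_iff)
  then show "m = m'" unfolding ij kl by (auto simp: add.commute)
qed

lemma neighborhood_disjoint:
  assumes "v \<in> neighborhood E p" "v \<in> neighborhood E q"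
  shows "p = q"
proof -
  have "\<not> p < q" if "v \<in> neighborhood E p" "v \<in> neighborhood E q" for p q
    using that by (auto simp: neighborhood_def)
  then show ?thesis using assms by (metis linorder_neqE_nat)
qed

lemma neighborhood_0: "neighborhood E 0 = root_verts E"
  by (auto simp: neighborhood_def)

locale normal_ordering =
  fixes F :: "'n::finite mono set" and x :: "nat \<Rightarrow> 'n" and f :: "nat \<Rightarrow> 'n mono"
  assumes degree_2: "\<forall>m\<in>F. mdeg m = 2" and normal: "normal_form F x f"
begin

abbreviation "E \<equiv> graph F"

definition r :: nat where "r = card (root_verts E)"

lemma normal_form_facts:
  shows bij_x: "bij_betw x {..<CARD('n)} UNIV" and bij_f: "bij_betw f {..<CARD('n)} F"
    and circuit: "is_circuit E (map x [0..<r])"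
    and root_circuit: "root_circuit E = (x ` {..<r}, circuit_edges (map x [0..<r]))"
    and f_circuit: "\<And>i. i < r \<Longrightarrow> f i = var (x i) + var (x (Suc i mod r))"
    and sorted: "\<And>i j p q. r \<le> i \<Longrightarrow> i < j \<Longrightarrow> j < CARD('n) \<Longrightarrow>
             x i \<in> neighborhood E p \<Longrightarrow> x j \<in> neighborhood E q \<Longrightarrow> p \<le> q"
    and f_tree: "\<And>i. r \<le> i \<Longrightarrow> i < CARD('n) \<Longrightarrow>
             \<exists>p u. x i \<in> neighborhood E (Suc p) \<and> u \<in> neighborhood E p \<and> f i = var u + var (x i)"
  using normal unfolding normal_form_def Let_def r_def[symmetric] by blast+

lemma r_pos: "0 < r" and r_neq_2: "r \<noteq> 2"
  using circuit by (auto simp: is_circuit_def)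

lemma r_le: "r \<le> CARD('n)"
  unfolding r_def by (simp add: card_mono)

lemma x_eq_iff: "i < CARD('n) \<Longrightarrow> j < CARD('n) \<Longrightarrow> x i = x j \<longleftrightarrow> i = j"
  using bij_x by (auto simp: bij_betw_def inj_on_def)

lemma x_cases: obtains i where "i < CARD('n)" "v = x i"
  using bij_x by (metis UNIV_I bij_betw_def imageE lessThan_iff)

lemma x_root_iff: "i < CARD('n) \<Longrightarrow> x i \<in> root_verts E \<longleftrightarrow> i < r"
  using x_eq_iff r_le root_circuit by (auto simp: image_iff) 

text \<open>
  The enumeration does not decrease the distance from the circuit, so a neighbour that is closer
  to the circuit comes earlier.
\<close>

lemma parent_exists:
  assumes "r \<le> i" "i < CARD('n)"
  shows "\<exists>j. j < i \<and> f i = var (x j) + var (x i) \<and>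
             (\<exists>p. x i \<in> neighborhood E (Suc p) \<and> x j \<in> neighborhood E p)"
proof -
  obtain p u where u: "x i \<in> neighborhood E (Suc p)" "u \<in> neighborhood E p" "f i = var u + var (x i)"
    using f_tree assms by blast
  obtain j where j: "j < CARD('n)" "u = x j" using x_cases by blast
  have "\<not> i < j"
  proof
    assume "i < j"
    then have "Suc p \<le> p" using sorted[of i j "Suc p" p] assms j u by blast
    then show False by simp
  qed
  moreover have "i \<noteq> j" using u j neighborhood_disjoint by fastforce
  ultimately show ?thesis using u j by (intro exI[of _ j]) auto
qed

definition par :: "nat \<Rightarrow> nat" where
  "par i = (SOME j. j < i \<and> f i = var (x j) + var (x i) \<and>
             (\<exists>p. x i \<in> neighborhood E (Suc p) \<and> x j \<in> neighborhood E p))"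

lemma par:
  assumes "r \<le> i" "i < CARD('n)"
  shows "par i < i" and f_par: "f i = var (x (par i)) + var (x i)"
    and neighborhood_par: "\<exists>p. x i \<in> neighborhood E (Suc p) \<and> x (par i) \<in> neighborhood E p"
  using someI_ex[OF parent_exists[OF assms]] unfolding par_def[symmetric] by blast+

sublocale rooted_unicyclic "CARD('n)" r par
  by unfold_locales (use r_pos r_le par(1) in auto)

lemma Suc_mod_less: "Suc i mod r < CARD('n)"
  using r_pos r_le by (meson mod_less_divisor less_le_trans)

lemma lookup_f: 
  assumes "i < CARD('n)" "j < CARD('n)"
  shows "int (Poly_Mapping.lookup (f j) (x i)) = incid i j"
proof (cases "j < r")
  case True
  then show ?thesis using assms Suc_mod_less[of j]
    by (simp add: f_circuit incid_def lookup_add lookup_var x_eq_iff)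
next
  case False
  then have "par j < CARD('n)" using par(1)[of j] assms by simp
  then show ?thesis using False assms
    by (simp add: f_par incid_def lookup_add lookup_var x_eq_iff)
qed

text \<open>
  For even \<open>r\<close>, the signs \<open>(-1)\<^sup>j\<close> on the circuit are consistent with the edge closing it, and
  changing the sign at each step away from it extends them to a proper 2-colouring of the graph.
\<close>

lemma cremona_odd:
  assumes "cremona_set TYPE('k::field) F"
  shows "odd r"
proof
  assume even: "even r"
  then have "2 \<le> r" using r_pos by presburger
  define c :: "nat \<Rightarrow> int" where "c = climb (\<lambda>j. (- 1) ^ j) (\<lambda>_ a. - a)"
  \<comment> \<open>The weight of a monomial: its pairing with the 2-colouring.\<close>
  define w where "w m = (\<Sum>i<CARD('n). int (Poly_Mapping.lookup m (x i)) * c i)" for m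
  have add: "w (a + b) = w a + w b" for a b
    by (simp add: w_def lookup_add algebra_simps sum.distrib)
  have w_var: "w (var (x j)) = c j" if "j < CARD('n)" for j
  proof -
    have "w (var (x j)) = (\<Sum>i<CARD('n). if i = j then c i else 0)"
      unfolding w_def by (rule sum.cong) (use that in \<open>auto simp: lookup_var x_eq_iff\<close>)
    then show ?thesis using that by simp
  qed
  have "w (f j) = 0" if "j < CARD('n)" for j
  proof (cases "j < r")
    case True
    have "c (Suc j mod r) = - c j"
    proof (cases "Suc j = r")
      case True
      then have "odd j" using even by (metis even_Suc)
      then show ?thesis using True \<open>j < r\<close> r_pos by (simp add: c_def climb_root)
    next
      case False
      then show ?thesis using True by (simp add: c_def climb_root)
    qed
    then show ?thesis using True that Suc_mod_less by (simp add: f_circuit add w_var)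
  next
    case False
    then have "par j < CARD('n)" using par(1)[of j] that by simp
    then show ?thesis using False that by (simp add: f_par add w_var c_def climb_child)
  qed
  then have "w m = 0" if "m \<in> F" for m
    using that bij_f by (auto simp: bij_betw_def)
  then have "w (var (x 0)) = w (var (x 1))"
    by (rule cremona_set_weight_constant[OF assms add])
  then show False
    using \<open>2 \<le> r\<close> r_le by (simp add: w_var c_def climb_root)
qed

lemma edges: "E = (\<lambda>j. Poly_Mapping.keys (f j)) ` {..<CARD('n)}" "inj_on (\<lambda>j. Poly_Mapping.keys (f j)) {..<CARD('n)}"
  using graph_eq_keys[OF degree_2] inj_on_keys_degree_2[OF degree_2] bij_f
  by (auto simp: bij_betw_def image_image[symmetric] intro: comp_inj_on[unfolded comp_def])

lemma in_keys_f: "i < CARD('n) \<Longrightarrow> j < CARD('n) \<Longrightarrow> x i \<in> Poly_Mapping.keys (f j) \<longleftrightarrow> incid i j \<noteq> 0"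
  by (simp add: in_keys_iff lookup_f[symmetric])

lemma card_edges:
  "card {e \<in> E. P e} = card {j. j < CARD('n) \<and> P (Poly_Mapping.keys (f j))}"
proof -
  have "{e \<in> E. P e} = (\<lambda>j. Poly_Mapping.keys (f j)) ` {j. j < CARD('n) \<and> P (Poly_Mapping.keys (f j))}"
    using edges(1) by auto
  then show ?thesis
    by (metis (no_types, lifting) card_image edges(2) inj_on_subset lessThan_iff mem_Collect_eq subsetI)
qed

lemma keys_f_tree: "r \<le> j \<Longrightarrow> j < CARD('n) \<Longrightarrow> Poly_Mapping.keys (f j) = {x (par j), x j}"
  by (simp add: f_par keys_var_add_var)

lemma keys_f_circuit: "j < r \<Longrightarrow> Poly_Mapping.keys (f j) = {x j, x (Suc j mod r)}"
  by (simp add: f_circuit keys_var_add_var)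

text \<open>
  The edge to the parent and one edge for each child; there is no loop off the circuit.
\<close>

lemma vdegree_tree:
  assumes "r \<le> i" "i < CARD('n)"
  shows "vdegree E (x i) = Suc (card {k. r \<le> k \<and> k < CARD('n) \<and> par k = i})"
proof -
  have "Poly_Mapping.keys (f j) \<noteq> {x i}" if "j < CARD('n)" for j
  proof (cases "j < r")
    case True
    then have "x j \<noteq> x i" "x j \<in> Poly_Mapping.keys (f j)"
      using assms that by (auto simp: x_eq_iff keys_f_circuit)
    then show ?thesis by blast
  next
    case False
    then have "par j < j" using par(1) that by simp
    then have "x (par j) \<noteq> x j" using that by (simp add: x_eq_iff)
    then show ?thesis using False that by (auto simp: keys_f_tree doubleton_eq_iff)
  qed
  then have "{j. j < CARD('n) \<and> Poly_Mapping.keys (f j) = {x i}} = {}" by blast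
  moreover have "{j. j < CARD('n) \<and> x i \<in> Poly_Mapping.keys (f j)} = insert i {k. r \<le> k \<and> k < CARD('n) \<and> par k = i}"
    (is "?L = ?R")
  proof -
    have "j \<in> ?L \<longleftrightarrow> j \<in> ?R" for j
    proof (cases "j < r")
      case True
      have "Suc j mod r < r" using r_pos by simp
      then have "i \<noteq> Suc j mod r" using assms by linarith
      then show ?thesis using True assms by (auto simp: in_keys_f incid_def)
    next
      case False
      then show ?thesis using assms par(1)[of i] by (auto simp: in_keys_f incid_def)
    qed
    then show ?thesis by blast
  qed
  moreover have "i \<notin> {k. r \<le> k \<and> k < CARD('n) \<and> par k = i}"
    using par(1)[of i] by auto
  ultimately show ?thesis unfolding vdegree_def card_edges by simp
qed

lemma vdegree_root:
  assumes "i < r"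
  shows "vdegree E (x i) \<ge> 2"
proof (cases "r = 1")
  case True
  then have "Poly_Mapping.keys (f 0) = {x i}" using assms by (simp add: keys_f_circuit)
  then have "{x i} \<in> E" unfolding edges(1) by (intro image_eqI[of _ _ 0]) auto
  then have "card {e \<in> E. x i \<in> e} > 0" "card {e \<in> E. e = {x i}} > 0"
    by (auto simp: card_gt_0_iff)
  then show ?thesis unfolding vdegree_def by simp
next
  case False
  \<comment> \<open>The predecessor on the circuit, which differs from \<open>i\<close> because the circuit is not a loop.\<close>
  define p where "p = (if i = 0 then r - 1 else i - 1)"
  have p: "p < r" "Suc p mod r = i" "p \<noteq> i"
    using assms False r_neq_2 r_pos by (auto simp: p_def)
  have "{p, i} \<subseteq> {j. j < CARD('n) \<and> x i \<in> Poly_Mapping.keys (f j)}"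
    using p assms r_le by (auto simp: keys_f_circuit)
  then have "card {p, i} \<le> card {j. j < CARD('n) \<and> x i \<in> Poly_Mapping.keys (f j)}"
    by (intro card_mono) auto
  then show ?thesis unfolding vdegree_def card_edges using p by simp
qed

lemma vdegree_tree_inner:
  assumes "r \<le> i" "i < CARD('n)"
  shows "vdegree E (x i) \<ge> 2 \<longleftrightarrow> inner i"
proof -
  have "finite {k. r \<le> k \<and> k < CARD('n) \<and> par k = i}" by simp
  then show ?thesis
    unfolding vdegree_tree[OF assms] inner_def using assms
    by (auto simp: Suc_le_eq card_gt_0_iff)
qed

lemma inner_iff:
  assumes "i < CARD('n)"
  shows "inner i \<longleftrightarrow> x i \<notin> root_verts E \<and> vdegree E (x i) \<ge> 2"
  using vdegree_tree_inner[of i] x_root_iff[OF assms] assms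
  by (cases "i < r") (auto simp: inner_def)

lemma card_inner: "card {v. v \<notin> root_verts E \<and> vdegree E v \<ge> 2} = card {i. inner i}"
proof -
  have "{v. v \<notin> root_verts E \<and> vdegree E v \<ge> 2} = x ` {i. inner i}"
  proof (intro equalityI subsetI)
    fix v assume v: "v \<in> {v. v \<notin> root_verts E \<and> vdegree E v \<ge> 2}"
    obtain i where "i < CARD('n)" "v = x i" by (rule x_cases)
    then show "v \<in> x ` {i. inner i}" using v inner_iff by blast
  qed (use inner_iff inner_less in auto)
  moreover have "inj_on x {i. inner i}"
    using bij_x inner_less by (auto simp: bij_betw_def intro: inj_on_subset)
  ultimately show ?thesis by (simp add: card_image)
qed

lemma root_edges_eq: "root_edges E = (\<lambda>j. Poly_Mapping.keys (f j)) ` {..<r}"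
proof -
  have "circuit_edges (map x [0..<r]) = {{x i, x (Suc i mod r)} | i. i < r}"
    using r_pos by (force simp: circuit_edges_def)
  then show ?thesis using root_circuit by (auto simp: keys_f_circuit)
qed

text \<open>
  An edge off the circuit survives pruning as soon as its far endpoint does: its near endpoint lies on
  the circuit or has a parent and a child, and so has degree at least 2.
\<close>

lemma pruned_monomials:
  "{m \<in> F. Poly_Mapping.keys m \<in> pruned E - root_edges E} = f ` {j. inner j}"
proof -
  have "Poly_Mapping.keys (f j) \<in> pruned E - root_edges E \<longleftrightarrow> inner j" if j: "j < CARD('n)" for j
  proof (cases "j < r")
    case True
    then show ?thesis by (auto simp: root_edges_eq inner_def)
  next
    case False
    have "Poly_Mapping.keys (f j) \<in> E" using j edges(1) by blast
    moreover have "Poly_Mapping.keys (f j) \<notin> root_edges E"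
      unfolding root_edges_eq using False j r_le by (auto dest: inj_onD[OF edges(2)])
    moreover have "vdegree E (x (par j)) \<ge> 2"
      using vdegree_root[of "par j"] vdegree_tree_inner[of "par j"] inner_par[of j] par(1)[of j] False j
      by (cases "par j < r") auto
    moreover have "vdegree E (x j) \<noteq> 1 \<longleftrightarrow> inner j"
    proof -
      have "vdegree E (x j) \<noteq> 1 \<longleftrightarrow> vdegree E (x j) \<ge> 2"
        using vdegree_tree[of j] False j by linarith
      then show ?thesis using vdegree_tree_inner[of j] False j by simp
    qed
    ultimately show ?thesis using False j by (auto simp: pruned_def keys_f_tree)
  qed
  then have "{j. j < CARD('n) \<and> Poly_Mapping.keys (f j) \<in> pruned E - root_edges E} = {j. inner j}"
    using inner_less by blast
  moreover have "{m \<in> F. Poly_Mapping.keys m \<in> pruned E - root_edges E}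
      = f ` {j. j < CARD('n) \<and> Poly_Mapping.keys (f j) \<in> pruned E - root_edges E}"
    using bij_f by (auto simp: bij_betw_def)
  ultimately show ?thesis by simp
qed

text \<open>
  A child of an inner vertex lies at distance at least 2, and the parents of a vertex at larger distance
  lead down to one at distance exactly 2. Conversely, the parent of a vertex at distance 2 is
  inner.
\<close>

lemma second_neighborhood_empty: "neighborhood E 2 = {} \<longleftrightarrow> (\<forall>i. \<not> inner i)"
proof
  assume empty: "neighborhood E 2 = {}"
  have far: "v \<notin> neighborhood E (q + 2)" for q v
  proof (induction q arbitrary: v)
    case (Suc q)
    show ?case
    proof
      assume v: "v \<in> neighborhood E (Suc q + 2)"
      obtain i where i: "i < CARD('n)" "v = x i" by (rule x_cases)
      have "r \<le> i"
        using v i x_root_iff neighborhood_disjoint[of v E "Suc q + 2" 0] neighborhood_0[of E]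
        by (metis add_is_0 nat.distinct(1) not_less)
      then obtain p where "x i \<in> neighborhood E (Suc p)" "x (par i) \<in> neighborhood E p"
        using neighborhood_par i by blast
      moreover from this have "p = q + 2" using v i neighborhood_disjoint by fastforce
      ultimately show False using Suc by blast
    qed
  qed (use empty in \<open>simp add: numeral_2_eq_2\<close>)
  show "\<forall>i. \<not> inner i"
  proof (intro allI notI)
    fix i assume "inner i"
    then obtain k where k: "r \<le> i" "i < CARD('n)" "r \<le> k" "k < CARD('n)" "par k = i"
      using inner_def inner_less by auto
    then obtain p q where "x i \<in> neighborhood E (Suc p)" "x k \<in> neighborhood E (Suc q)"
      "x i \<in> neighborhood E q" using neighborhood_par by metis
    then have "x k \<in> neighborhood E (p + 2)" using neighborhood_disjoint by fastforce
    then show False using far by blast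
  qed
next
  assume none: "\<forall>i. \<not> inner i"
  show "neighborhood E 2 = {}"
  proof (rule ccontr)
    assume "neighborhood E 2 \<noteq> {}"
    then obtain i where i: "i < CARD('n)" "x i \<in> neighborhood E 2" using x_cases by (metis ex_in_conv)
    have off: "r \<le> k" if "k < CARD('n)" "x k \<in> neighborhood E (Suc q)" for k q
      using that x_root_iff neighborhood_disjoint[of "x k" E "Suc q" 0] neighborhood_0[of E]
      by (metis nat.distinct(1) not_less)
    have ri: "r \<le> i" using off[of i 1] i by (simp add: numeral_2_eq_2)
    then obtain p where p: "x i \<in> neighborhood E (Suc p)" "x (par i) \<in> neighborhood E p"
      using neighborhood_par i by blast
    then have "p = Suc 0" using i neighborhood_disjoint by fastforce
    then have "r \<le> par i" using off[of "par i" 0] p par(1)[OF ri] i by simp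
    then show False using none inner_par ri i by blast
  qed
qed

end

section \<open>The Cremona inverse\<close>

locale cremona_normal_ordering = normal_ordering F x f
  for F :: "'n::finite mono set" and x :: "nat \<Rightarrow> 'n" and f :: "nat \<Rightarrow> 'n mono" +
  assumes odd_circuit: "odd r" and two_variables: "2 \<le> CARD('n)"
begin

sublocale odd_rooted_unicyclic "CARD('n)" r par
  by unfold_locales (use odd_circuit two_variables in auto)

definition inv_mono :: "nat \<Rightarrow> 'n mono" where
  "inv_mono j = Abs_poly_mapping (\<lambda>v. nat (entry (the_inv_into {..<CARD('n)} x v) j))"

definition inv_factor :: "'n mono" where
  "inv_factor = (\<Sum>i<r. var (x i)) + (\<Sum>m\<in>f ` {j. inner j}. m)"

lemma lookup_inv_mono:
  assumes "i < CARD('n)" "j < CARD('n)"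
  shows "int (Poly_Mapping.lookup (inv_mono j) (x i)) = entry i j"
proof -
  have "the_inv_into {..<CARD('n)} x (x i) = i"
    using bij_x assms by (intro the_inv_into_f_f) (auto simp: bij_betw_def)
  then show ?thesis using entry_range[OF assms] by (auto simp: inv_mono_def)
qed

lemma lookup_inv_factor:
  assumes "v < CARD('n)"
  shows "int (Poly_Mapping.lookup inv_factor (x v)) = factor v"
proof -
  have "inj_on f {j. inner j}"
    using bij_f inner_less by (auto simp: bij_betw_def intro: inj_on_subset)
  then have "int (Poly_Mapping.lookup inv_factor (x v))
      = (\<Sum>i<r. int (Poly_Mapping.lookup (var (x i)) (x v)))
        + (\<Sum>j\<in>{j. inner j}. int (Poly_Mapping.lookup (f j) (x v)))"
    by (simp add: inv_factor_def lookup_add lookup_sum sum.reindex)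
  also have "(\<Sum>i<r. int (Poly_Mapping.lookup (var (x i)) (x v))) = (\<Sum>i<r. if i = v then 1 else 0)"
    using assms r_le by (intro sum.cong) (auto simp: lookup_var x_eq_iff)
  also have "\<dots> = of_bool (v < r)" by simp
  also have "(\<Sum>j\<in>{j. inner j}. int (Poly_Mapping.lookup (f j) (x v)))
      = boundary (\<lambda>j. of_bool (inner j)) v"
    unfolding boundary_def using assms inner_less
    by (intro sum.mono_neutral_cong_left) (auto simp: lookup_f)
  finally show ?thesis by (simp add: factor_def)
qed

lemma log_matrix_product_iff:
  "log_matrix x f * log_matrix x g
     = mat CARD('n) CARD('n) (\<lambda>(i, j). Poly_Mapping.lookup \<gamma> (x i)) + 1\<^sub>m CARD('n)
   \<longleftrightarrow> (\<forall>v<CARD('n). \<forall>j<CARD('n).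
          boundary (\<lambda>i. int (Poly_Mapping.lookup (g j) (x i))) v
            = int (Poly_Mapping.lookup \<gamma> (x v)) + of_bool (v = j))"
proof -
  let ?A = "log_matrix x f * log_matrix x g"
  let ?C = "mat CARD('n) CARD('n) (\<lambda>(i, j). Poly_Mapping.lookup \<gamma> (x i)) + 1\<^sub>m CARD('n)"
  have A: "int (?A $$ (v, j)) = boundary (\<lambda>i. int (Poly_Mapping.lookup (g j) (x i))) v"
    if "v < CARD('n)" "j < CARD('n)" for v j
    using that
    by (simp add: log_matrix_def scalar_prod_def boundary_def lookup_f[symmetric] lessThan_atLeast0)
  have C: "int (?C $$ (v, j)) = int (Poly_Mapping.lookup \<gamma> (x v)) + of_bool (v = j)"
    if "v < CARD('n)" "j < CARD('n)" for v j
    using that by simp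
  have dim: "dim_row ?A = CARD('n)" "dim_col ?A = CARD('n)"
    "dim_row ?C = CARD('n)" "dim_col ?C = CARD('n)"
    by (simp_all add: log_matrix_def)
  have "?A = ?C \<longleftrightarrow> (\<forall>v<CARD('n). \<forall>j<CARD('n). int (?A $$ (v, j)) = int (?C $$ (v, j)))"
    unfolding mat_eq_iff dim of_nat_eq_iff by blast
  then show ?thesis by (auto simp: A C simp del: index_add_mat)
qed

text \<open>
  The columns are distinct because their boundaries \<open>\<gamma> + e\<^sub>j\<close> are. The canonical restrictions hold
  since each row has a zero and a nonzero diagonal entry. All column sums agree because
  the boundaries have the same total.
\<close>

lemma is_cremona_inverse_inv_mono:
  "is_cremona_inverse x f (inv_mono ` {..<CARD('n)}) (log_matrix x inv_mono) inv_factor"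
  and mdeg_inv_mono: "j < CARD('n) \<Longrightarrow> 2 * mdeg (inv_mono j) = r + 1 + 2 * card {i. inner i}"
proof -
  have cong: "boundary (\<lambda>i. int (Poly_Mapping.lookup (inv_mono j) (x i))) v = boundary (\<lambda>i. entry i j) v"
    if "j < CARD('n)" for j v
    unfolding boundary_def using that by (intro sum.cong) (auto simp: lookup_inv_mono)
  have eq: "boundary (\<lambda>i. int (Poly_Mapping.lookup (inv_mono j) (x i))) v
      = factor v + of_bool (v = j)" if "v < CARD('n)" "j < CARD('n)" for v j
    using that by (simp add: cong boundary_entry)
  have deg: "2 * mdeg (inv_mono j) = r + 1 + 2 * card {i. inner i}" if "j < CARD('n)" for j
  proof -
    have "int (mdeg (inv_mono j)) = (\<Sum>i<CARD('n). int (Poly_Mapping.lookup (inv_mono j) (x i)))"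
      unfolding mdeg_def of_nat_sum
      by (rule sum.reindex_bij_betw[OF bij_x, symmetric])
    also have "\<dots> = (\<Sum>i<CARD('n). entry i j)"
      using that by (intro sum.cong) (auto simp: lookup_inv_mono)
    finally show ?thesis using entry_column_sum[OF that] by linarith
  qed
  show "j < CARD('n) \<Longrightarrow> 2 * mdeg (inv_mono j) = r + 1 + 2 * card {i. inner i}" by (rule deg)
  have inj: "inj_on inv_mono {..<CARD('n)}"
  proof (rule inj_onI)
    fix j k assume jk: "j \<in> {..<CARD('n)}" "k \<in> {..<CARD('n)}" "inv_mono j = inv_mono k"
    then have "factor j + of_bool (j = j) = factor j + of_bool (j = k)"
      using eq[of j j] eq[of j k] by simp
    then show "j = k" by (simp split: if_splits)
  qed
  have canonical: "canonical_restrictions (inv_mono ` {..<CARD('n)})"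
    unfolding canonical_restrictions_def
  proof (intro conjI allI impI)
    fix u assume u: "\<forall>m\<in>inv_mono ` {..<CARD('n)}. mono_dvd u m"
    show "u = 0"
    proof (rule poly_mapping_eqI)
      fix v
      obtain i where i: "i < CARD('n)" "v = x i" by (rule x_cases)
      obtain j where j: "j < CARD('n)" "entry i j = 0" using entry_zero i by blast
      have "Poly_Mapping.lookup u v \<le> Poly_Mapping.lookup (inv_mono j) v"
        using u j by (auto simp: mono_dvd_iff)
      then show "Poly_Mapping.lookup u v = Poly_Mapping.lookup 0 v"
        using lookup_inv_mono[of i j] i j by simp
    qed
  next
    fix v
    obtain i where i: "i < CARD('n)" "v = x i" by (rule x_cases)
    then have "Poly_Mapping.lookup (inv_mono i) v \<noteq> 0"
      using lookup_inv_mono[of i i] entry_diag_nonzero[of i] by simp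
    then show "\<exists>m\<in>inv_mono ` {..<CARD('n)}. mono_dvd (var v) m"
      using i by (auto simp: mono_dvd_var_iff)
  qed
  show "is_cremona_inverse x f (inv_mono ` {..<CARD('n)}) (log_matrix x inv_mono) inv_factor"
    unfolding is_cremona_inverse_def log_matrix_product_iff
  proof (intro conjI)
    show "\<exists>g. bij_betw g {..<CARD('n)} (inv_mono ` {..<CARD('n)}) \<and> log_matrix x inv_mono = log_matrix x g"
      using inj by (auto simp: bij_betw_def)
    have "mdeg (inv_mono j) = mdeg (inv_mono 0)" if "j < CARD('n)" for j
      using deg[OF that] deg[of 0] by simp
    then show "\<exists>d. \<forall>m\<in>inv_mono ` {..<CARD('n)}. mdeg m = d" by blast
  next
    show "canonical_restrictions (inv_mono ` {..<CARD('n)})" by (rule canonical)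
  next
    show "\<forall>v<CARD('n). \<forall>j<CARD('n).
        boundary (\<lambda>i. int (Poly_Mapping.lookup (inv_mono j) (x i))) v
          = int (Poly_Mapping.lookup inv_factor (x v)) + of_bool (v = j)"
      by (simp add: eq lookup_inv_factor)
  qed
qed

text \<open>
  Corresponding columns of two solutions differ by a weighting whose boundary \<open>\<gamma> - \<gamma>'\<close> does not depend
  on the column; by injectivity of the boundary, neither does the difference itself. In each row both solutions have a
  zero, so the constant difference is both \<open>\<le> 0\<close> and \<open>\<ge> 0\<close>.
\<close>

lemma is_cremona_inverse_unique:
  assumes "is_cremona_inverse x f G B \<gamma>" "is_cremona_inverse x f G' B' \<gamma>'"
  shows "G = G' \<and> B = B' \<and> \<gamma> = \<gamma>'"
proof -
  have data: "\<exists>g. G = g ` {..<CARD('n)} \<and> B = log_matrix x g \<and>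
      (\<forall>v<CARD('n). \<forall>j<CARD('n). boundary (\<lambda>i. int (Poly_Mapping.lookup (g j) (x i))) v
            = int (Poly_Mapping.lookup \<gamma> (x v)) + of_bool (v = j)) \<and>
      (\<forall>i. \<exists>j<CARD('n). Poly_Mapping.lookup (g j) (x i) = 0)"
    if inv: "is_cremona_inverse x f G B \<gamma>" for G B \<gamma>
  proof -
    obtain g where g: "bij_betw g {..<CARD('n)} G" "B = log_matrix x g"
      using inv unfolding is_cremona_inverse_def by blast
    have "\<exists>j<CARD('n). Poly_Mapping.lookup (g j) (x i) = 0" for i
    proof (rule ccontr)
      assume "\<not> ?thesis"
      then have "\<forall>m\<in>G. mono_dvd (var (x i)) m"
        using g by (auto simp: mono_dvd_var_iff bij_betw_def)
      then have "var (x i) = 0"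
        using inv unfolding is_cremona_inverse_def canonical_restrictions_def by blast
      then show False using lookup_var[of "x i" "x i"] by simp
    qed
    then show ?thesis
      using inv g unfolding is_cremona_inverse_def
      by (intro exI[of _ g]) (auto simp: log_matrix_product_iff bij_betw_def)
  qed
  obtain g where g: "G = g ` {..<CARD('n)}" "B = log_matrix x g"
      "\<And>v j. v < CARD('n) \<Longrightarrow> j < CARD('n) \<Longrightarrow> boundary (\<lambda>i. int (Poly_Mapping.lookup (g j) (x i))) v
            = int (Poly_Mapping.lookup \<gamma> (x v)) + of_bool (v = j)"
      "\<And>i. \<exists>j<CARD('n). Poly_Mapping.lookup (g j) (x i) = 0"
    using data[OF assms(1)] by blast
  obtain g' where g': "G' = g' ` {..<CARD('n)}" "B' = log_matrix x g'"
      "\<And>v j. v < CARD('n) \<Longrightarrow> j < CARD('n) \<Longrightarrow> boundary (\<lambda>i. int (Poly_Mapping.lookup (g' j) (x i))) v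
            = int (Poly_Mapping.lookup \<gamma>' (x v)) + of_bool (v = j)"
      "\<And>i. \<exists>j<CARD('n). Poly_Mapping.lookup (g' j) (x i) = 0"
    using data[OF assms(2)] by blast
  define d where "d j i = int (Poly_Mapping.lookup (g j) (x i)) - int (Poly_Mapping.lookup (g' j) (x i))" for j i
  have d: "boundary (d j) v = int (Poly_Mapping.lookup \<gamma> (x v)) - int (Poly_Mapping.lookup \<gamma>' (x v))"
    if "v < CARD('n)" "j < CARD('n)" for v j
    using that unfolding d_def boundary_diff by (simp add: g(3) g'(3))
  have same: "d j i = d k i" if "i < CARD('n)" "j < CARD('n)" "k < CARD('n)" for i j k
    using boundary_inj[of "\<lambda>i. d j i - d k i" i] that by (simp add: boundary_diff d)
  have lookup_eq: "Poly_Mapping.lookup (g j) (x i) = Poly_Mapping.lookup (g' j) (x i)" if i: "i < CARD('n)" and j: "j < CARD('n)" for i j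
  proof -
    obtain k where k: "k < CARD('n)" "Poly_Mapping.lookup (g k) (x i) = 0" using g(4) by blast
    obtain l where l: "l < CARD('n)" "Poly_Mapping.lookup (g' l) (x i) = 0" using g'(4) by blast
    have "d j i \<le> 0" "d j i \<ge> 0" using same[OF i j k(1)] same[OF i j l(1)] k l by (simp_all add: d_def)
    then show ?thesis by (simp add: d_def)
  qed
  have "g j = g' j" if "j < CARD('n)" for j
  proof (rule poly_mapping_eqI)
    fix v
    obtain i where "i < CARD('n)" "v = x i" by (rule x_cases)
    then show "Poly_Mapping.lookup (g j) v = Poly_Mapping.lookup (g' j) v" using lookup_eq that by simp
  qed
  then have "G = G'" unfolding g(1) g'(1) by simp
  moreover have "B = B'" unfolding g(2) g'(2) log_matrix_def by (rule cong_mat) (auto simp: lookup_eq)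
  moreover have "\<gamma> = \<gamma>'"
  proof (rule poly_mapping_eqI)
    fix v
    obtain i where i: "i < CARD('n)" "v = x i" by (rule x_cases)
    have "boundary (d 0) i = 0"
      unfolding boundary_def by (rule sum.neutral) (auto simp: d_def lookup_eq)
    then show "Poly_Mapping.lookup \<gamma> v = Poly_Mapping.lookup \<gamma>' v" using d[of i 0] i by simp
  qed
  ultimately show ?thesis by blast
qed

lemma cremona_inverse_eq:
  "cremona_inverse x f = (inv_mono ` {..<CARD('n)}, log_matrix x inv_mono, inv_factor)"
  unfolding cremona_inverse_def
proof (rule the_equality)
  fix T assume T: "case T of (G, B, \<gamma>) \<Rightarrow> is_cremona_inverse x f G B \<gamma>"
  obtain G B \<gamma> where "T = (G, B, \<gamma>)" by (cases T)
  then show "T = (inv_mono ` {..<CARD('n)}, log_matrix x inv_mono, inv_factor)"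
    using T is_cremona_inverse_unique[OF _ is_cremona_inverse_inv_mono] by simp
qed (simp add: is_cremona_inverse_inv_mono)

lemma common_degree_inverse:
  "2 * common_degree (inv_mono ` {..<CARD('n)}) = r + 1 + 2 * card {i. inner i}"
proof -
  have "mdeg (inv_mono j) = mdeg (inv_mono 0)" if "j < CARD('n)" for j
    using mdeg_inv_mono[OF that] mdeg_inv_mono[of 0] by simp
  then have all: "\<forall>m\<in>inv_mono ` {..<CARD('n)}. mdeg m = mdeg (inv_mono 0)"
    by blast
  have "inv_mono 0 \<in> inv_mono ` {..<CARD('n)}" by simp
  then have "common_degree (inv_mono ` {..<CARD('n)}) = mdeg (inv_mono 0)"
    unfolding common_degree_def using all by (intro the_equality) (blast, metis)
  then show ?thesis using mdeg_inv_mono[of 0] by simp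
qed

lemma squarefree_inverse_iff:
  "(\<forall>m\<in>inv_mono ` {..<CARD('n)}. squarefree_mono m) \<longleftrightarrow> neighborhood E 2 = {}"
proof -
  have "squarefree_mono (inv_mono j) \<longleftrightarrow> (\<forall>i<CARD('n). entry i j \<le> 1)" if "j < CARD('n)" for j
  proof -
    have "squarefree_mono (inv_mono j) \<longleftrightarrow> (\<forall>i<CARD('n). Poly_Mapping.lookup (inv_mono j) (x i) \<le> 1)"
      unfolding squarefree_mono_def by (metis x_cases)
    also have "\<dots> \<longleftrightarrow> (\<forall>i<CARD('n). entry i j \<le> 1)"
      using lookup_inv_mono[OF _ that] by force
    finally show ?thesis .
  qed
  then have "(\<forall>m\<in>inv_mono ` {..<CARD('n)}. squarefree_mono m)
      \<longleftrightarrow> (\<forall>i<CARD('n). \<forall>j<CARD('n). entry i j \<le> 1)" by auto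
  also have "\<dots> \<longleftrightarrow> (\<forall>i<CARD('n). \<not> (\<exists>j<CARD('n). entry i j = 2))"
    using entry_range by force
  also have "\<dots> \<longleftrightarrow> (\<forall>i. \<not> inner i)"
    using entry_two_iff inner_less by blast
  finally show ?thesis by (simp add: second_neighborhood_empty)
qed

lemma log_matrix_inverse:
  "i < CARD('n) \<Longrightarrow> j < CARD('n) \<Longrightarrow> int (log_matrix x inv_mono $$ (i, j)) = entry i j"
  by (simp add: log_matrix_def lookup_inv_mono)

end

theorem theorem2p6:
  fixes F :: "'n::finite mono set"
    and x :: "nat \<Rightarrow> 'n"
    and f :: "nat \<Rightarrow> 'n mono"
    and Finv :: "'n mono set"
    and B :: "nat mat"
    and \<gamma> :: "'n mono"
    and n r s :: nat
  assumes "n = CARD('n)" and "n \<ge> 2"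
    and cremona: "cremona_set TYPE('k::field) F"
    and degree_2: "\<forall>m\<in>F. mdeg m = 2"
    and canonical: "canonical_restrictions F"
    and r: "r = card (root_verts (graph F))"
    and s: "s = card {v. v \<notin> root_verts (graph F) \<and> vdegree (graph F) v \<ge> 2}"
    and normal: "normal_form F x f"
    and inverse: "(Finv, B, \<gamma>) = cremona_inverse x f"
  shows "real (common_degree Finv) = (real r + 1) / 2 + real s
    \<and> (\<forall>i<n. B $$ (i, i) \<noteq> 0)
    \<and> (\<forall>i<n. \<forall>j<n. B $$ (i, j) \<in> {0, 1, 2})
    \<and> (\<forall>i<n. (\<exists>j<n. B $$ (i, j) = 2) \<longleftrightarrow>
              x i \<notin> root_verts (graph F) \<and> vdegree (graph F) (x i) \<ge> 2)
    \<and> ((\<forall>m\<in>Finv. squarefree_mono m) \<longleftrightarrow> neighborhood (graph F) 2 = {})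
    \<and> \<gamma> = (\<Sum>i<r. var (x i)) +
            (\<Sum>m\<in>{m \<in> F. Poly_Mapping.keys m \<in> pruned (graph F) - root_edges (graph F)}. m)"
proof -
  interpret N: normal_ordering F x f
    using degree_2 normal by unfold_locales
  interpret C: cremona_normal_ordering F x f
    using N.cremona_odd[OF cremona] \<open>n = CARD('n)\<close> \<open>n \<ge> 2\<close> by unfold_locales auto
  have r_eq: "N.r = r" by (simp add: N.r_def r)
  have s_eq: "s = card {i. N.inner i}" by (simp add: s N.card_inner)
  have Finv: "Finv = C.inv_mono ` {..<n}" and B: "B = log_matrix x C.inv_mono"
    and \<gamma>: "\<gamma> = C.inv_factor"
    using inverse \<open>n = CARD('n)\<close> by (auto simp: C.cremona_inverse_eq)
  have entry: "int (B $$ (i, j)) = C.entry i j" if "i < n" "j < n" for i j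
    using that \<open>n = CARD('n)\<close> by (simp add: B C.log_matrix_inverse)
  have "real (2 * common_degree Finv) = real (r + 1 + 2 * s)"
    using C.common_degree_inverse \<open>n = CARD('n)\<close> by (simp add: Finv r_eq s_eq)
  then have "real (common_degree Finv) = (real r + 1) / 2 + real s" by (simp add: field_simps)
  moreover have "\<forall>i<n. B $$ (i, i) \<noteq> 0"
    using entry C.entry_diag_nonzero \<open>n = CARD('n)\<close> by (metis of_nat_0)
  moreover have "\<forall>i<n. \<forall>j<n. B $$ (i, j) \<in> {0, 1, 2}"
  proof (intro allI impI)
    fix i j assume "i < n" "j < n"
    then have "int (B $$ (i, j)) \<in> {0, 1, 2}"
      using entry[of i j] C.entry_range[of i j] \<open>n = CARD('n)\<close> by simp
    then show "B $$ (i, j) \<in> {0, 1, 2}" by auto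
  qed
  moreover have "(\<exists>j<n. B $$ (i, j) = 2) \<longleftrightarrow>
      x i \<notin> root_verts (graph F) \<and> vdegree (graph F) (x i) \<ge> 2" if "i < n" for i
  proof -
    have "B $$ (i, j) = 2 \<longleftrightarrow> C.entry i j = 2" if "j < n" for j
      using entry[OF \<open>i < n\<close> that] by linarith
    then have "(\<exists>j<n. B $$ (i, j) = 2) \<longleftrightarrow> N.inner i"
      using C.entry_two_iff[of i] that \<open>n = CARD('n)\<close> by auto
    then show ?thesis using N.inner_iff[of i] that \<open>n = CARD('n)\<close> by simp
  qed
  moreover have "(\<forall>m\<in>Finv. squarefree_mono m) \<longleftrightarrow> neighborhood (graph F) 2 = {}"
    using C.squarefree_inverse_iff \<open>n = CARD('n)\<close> by (simp add: Finv)
  moreover have "\<gamma> = (\<Sum>i<r. var (x i)) +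
      (\<Sum>m\<in>{m \<in> F. Poly_Mapping.keys m \<in> pruned (graph F) - root_edges (graph F)}. m)"
    by (simp only: \<gamma> C.inv_factor_def r_eq N.pruned_monomials)
  ultimately show ?thesis by blast
qed

end
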